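(* Let $p>1$ be an integer, let $\phi\ge 1$ be real, and let $\mathcal{B}(\phi)=[p/(2\phi-1),\,p(2\phi-1)]$. For every integer $b\ge1$, let $A(b)$ be the deterministic ski-rental algorithm with $b$ renting days. The policy class of $\phi$-degraded algorithms for the ski-rental problem (with baseline $A(p)$) is determined by $\mathcal{B}(\phi)$; that is, for every integer $b\ge 1$ with $b\in\mathcal{B}(\phi)$ the degradation factor of $A(b)$ with respect to $A(p)$ is at most $\phi$: $$\mathrm{CR}(A(b))\le \phi\,\mathrm{CR}(A(p)).$$
   Context: Ski-rental problem: a skier skis for an unknown number $x\in\{1,2,\dots\}$ of days. On each day the skier can rent skis at cost $1$, or buy them at the integer price $p>1$ and ski for free from then on. The offline optimal cost is $\min(x,p)$. Algorithm $A(b)$: rent for the first $b$ days, and buy on the next day if skiing continues. Thus its cost is $x$ if $x\le b$ and $b+p$ if $x>b$. The algorithm $A(p)$ is the $2$-competitive baseline. The competitive ratio $\mathrm{CR}(A)$ is the supremum over all $x\ge1$ of the cost of $A$ divided by the offline optimal cost. The degradation factor $\mathrm{DF}(A(b))$ relative to the baseline $A(p)$ is a factor satisfying $\mathrm{CR}(A(b))\le \mathrm{DF}(A(b))\,\mathrm{CR}(A(p))$. A class of algorithms is $\phi$-degraded if every algorithm in it has degradation factor at most $\phi$. *)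

theory Defs
  imports Complex_Main "HOL-Library.Extended_Real"
begin

datatype action = Rent | Buy

text \<open>A deterministic online algorithm prescribes, for each day \<open>t \<ge> 1\<close>, what to do if the skier
  is still skiing on day \<open>t\<close> and does not own skis yet. Actions prescribed after the first
  purchase are irrelevant.\<close>

type_synonym algorithm = "nat \<Rightarrow> action"

definition owns_before :: "algorithm \<Rightarrow> nat \<Rightarrow> bool" where
  "owns_before alg t \<longleftrightarrow> (\<exists>s\<in>{1..<t}. alg s = Buy)"

definition day_cost :: "nat \<Rightarrow> algorithm \<Rightarrow> nat \<Rightarrow> nat" where
  "day_cost p alg t =
     (if owns_before alg t then 0 else (case alg t of Rent \<Rightarrow> 1 | Buy \<Rightarrow> p))"

definition cost :: "nat \<Rightarrow> algorithm \<Rightarrow> nat \<Rightarrow> nat" where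
  "cost p alg x = (\<Sum>t=1..x. day_cost p alg t)"

definition opt_cost :: "nat \<Rightarrow> nat \<Rightarrow> nat" where
  "opt_cost p x = min x p"

text \<open>The supremum is taken in the extended reals, since it is infinite for an algorithm
  that never buys.\<close>

definition CR :: "nat \<Rightarrow> algorithm \<Rightarrow> ereal" where
  "CR p alg = (SUP x\<in>{1..}. ereal (real (cost p alg x) / real (opt_cost p x)))"

definition rent_then_buy :: "nat \<Rightarrow> algorithm" where
  "rent_then_buy b t = (if t \<le> b then Rent else Buy)"

definition is_degradation_factor :: "nat \<Rightarrow> algorithm \<Rightarrow> algorithm \<Rightarrow> real \<Rightarrow> bool" where
  "is_degradation_factor p base alg d \<longleftrightarrow> CR p alg \<le> ereal d * CR p base"

definition degraded_class :: "nat \<Rightarrow> algorithm \<Rightarrow> real \<Rightarrow> algorithm set \<Rightarrow> bool" where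
  "degraded_class p base \<phi> C \<longleftrightarrow>
     (\<forall>alg\<in>C. \<exists>d\<le>\<phi>. is_degradation_factor p base alg d)"

definition buy_range :: "nat \<Rightarrow> real \<Rightarrow> real set" where
  "buy_range p \<phi> = {real p / (2 * \<phi> - 1) .. real p * (2 * \<phi> - 1)}"

definition policy_class :: "nat \<Rightarrow> real \<Rightarrow> algorithm set" where
  "policy_class p \<phi> = {rent_then_buy b | b. b \<ge> 1 \<and> real b \<in> buy_range p \<phi>}"

lemma owns_before_rent_then_buy: "owns_before (rent_then_buy b) t \<longleftrightarrow> Suc b < t"
proof
  assume "Suc b < t"
  then show "owns_before (rent_then_buy b) t"
    unfolding owns_before_def rent_then_buy_def by (intro bexI[of _ "Suc b"]) auto
qed (auto simp: owns_before_def rent_then_buy_def split: if_splits)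

lemma cost_rent_then_buy: "cost p (rent_then_buy b) x = (if x \<le> b then x else b + p)"
proof (induction x)
  case 0
  show ?case by (simp add: cost_def)
next
  case (Suc x)
  have "cost p (rent_then_buy b) (Suc x) = cost p (rent_then_buy b) x + day_cost p (rent_then_buy b) (Suc x)"
    by (simp add: cost_def)
  moreover have "rent_then_buy b (Suc x) = (if Suc x \<le> b then Rent else Buy)"
    by (simp add: rent_then_buy_def)
  ultimately show ?case
    using Suc by (auto simp: day_cost_def owns_before_rent_then_buy)
qed

end

theory Submission
  imports Defs
begin

text \<open>The baseline has competitive ratio at least 2, attained on day \<open>p + 1\<close>. With an upper bound of
  \<open>2 * \<phi>\<close> on the ratio of \<open>A(b)\<close>, the right end of the buying range controls the cases \<open>x \<ge> p\<close>, where
  the optimum is \<open>p\<close>, and the left end the cases \<open>b < x < p\<close>, where the optimum is at least \<open>b\<close>.\<close>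

lemma CR_rent_then_buy_price_ge:
  assumes "p > 0"
  shows "2 \<le> CR p (rent_then_buy p)"
  unfolding CR_def
proof (rule SUP_upper2[of "Suc p"])
  show "2 \<le> ereal (real (cost p (rent_then_buy p) (Suc p)) / real (opt_cost p (Suc p)))"
    using assms by (simp add: cost_rent_then_buy opt_cost_def)
qed simp

lemma cost_rent_then_buy_le:
  assumes "\<phi> \<ge> 1" and "real b \<in> buy_range p \<phi>"
  shows "real (cost p (rent_then_buy b) x) \<le> 2 * \<phi> * real (opt_cost p x)"
proof -
  \<comment> \<open>The left end of the range, multiplied by \<open>2 * \<phi> - 1 > 0\<close>,
    gives \<open>p \<le> (2 * \<phi> - 1) * b\<close>.\<close>
  have lower: "real p + real b \<le> 2 * \<phi> * real b"
    using assms by (simp add: buy_range_def field_simps)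
  have upper: "real b + real p \<le> 2 * \<phi> * real p"
    using assms by (simp add: buy_range_def algebra_simps)
  have lower': "real b + real p \<le> 2 * \<phi> * real x" if "b \<le> x"
  proof -
    have "2 * \<phi> * real b \<le> 2 * \<phi> * real x"
      using that assms(1) by (intro mult_left_mono) auto
    then show ?thesis
      using lower by linarith
  qed
  have rent: "real x \<le> 2 * \<phi> * real x"
    using mult_right_mono[of 1 "2 * \<phi>" "real x"] assms(1) by simp
  \<comment> \<open>\<open>rent\<close> settles \<open>x \<le> b\<close> with
    \<open>x \<le> p\<close>, \<open>lower'\<close> settles \<open>b < x \<le> p\<close>, and
    \<open>upper\<close> settles \<open>x > p\<close>, including a skier still renting, whose cost
    is \<open>x \<le> b \<le> b + p\<close>.\<close>
  show ?thesis
    using lower' upper rent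
    by (auto simp: cost_rent_then_buy opt_cost_def min_def)
qed

lemma CR_rent_then_buy_le:
  assumes "p > 0" and "\<phi> \<ge> 1" and "real b \<in> buy_range p \<phi>"
  shows "CR p (rent_then_buy b) \<le> ereal (2 * \<phi>)"
  unfolding CR_def
proof (rule SUP_least)
  fix x :: nat
  assume "x \<in> {1..}"
  \<comment> \<open>A positive optimum lets the pointwise bound be divided through.\<close>
  then have "real (opt_cost p x) > 0"
    using assms(1) by (simp add: opt_cost_def)
  then show "ereal (real (cost p (rent_then_buy b) x) / real (opt_cost p x)) \<le> ereal (2 * \<phi>)"
    using cost_rent_then_buy_le[OF assms(2,3), of x] by (simp add: divide_le_eq)
qed

theorem corollary2p2:
  fixes p :: nat and \<phi> :: real
  assumes "p > 1" and "\<phi> \<ge> 1"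
  shows "degraded_class p (rent_then_buy p) \<phi> (policy_class p \<phi>) \<and>
         (\<forall>b::nat. b \<ge> 1 \<and> real b \<in> buy_range p \<phi> \<longrightarrow> CR p (rent_then_buy b) \<le> ereal \<phi> * CR p (rent_then_buy p))"
proof -
  have *: "CR p (rent_then_buy b) \<le> ereal \<phi> * CR p (rent_then_buy p)"
    if "real b \<in> buy_range p \<phi>" for b
  proof -
    have "CR p (rent_then_buy b) \<le> ereal (2 * \<phi>)"
      using assms that by (intro CR_rent_then_buy_le) auto
    \<comment> \<open>The factor 2 is split off so that the ratio of the baseline can replace
      it.\<close>
    also have "\<dots> = ereal \<phi> * 2"
      by (simp flip: numeral_eq_ereal times_ereal.simps add: mult.commute)
    also have "\<dots> \<le> ereal \<phi> * CR p (rent_then_buy p)"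
      using assms by (intro ereal_mult_left_mono CR_rent_then_buy_price_ge) auto
    finally show ?thesis .
  qed
  \<comment> \<open>For each member of the class, \<open>\<phi>\<close> itself serves as the factor
    \<open>d\<close>.\<close>
  then show ?thesis
    by (auto simp: degraded_class_def policy_class_def is_degradation_factor_def)
qed

end
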